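(* If $n\geq 1$ then $|q_n(q_nz-p_n)|$ is less than each of $$\text{i) }\frac{\mu}{(1-\varepsilon^2)|z_n|},\qquad\text{ii) }\frac{(1+\varepsilon^2)\mu^2}{(1-\varepsilon^2)|a_{n+1}|},\qquad\text{iii) }\frac{\mu|q_n|}{(1-\varepsilon^2)|q_{n+1}|}.$$
   Context: Let $\mathcal{O}=\mathbb{Z}[\tau]$ be the ring of discriminant $\Delta$ in an imaginary quadratic field $K$. An ideal is reduced if it is integral and has minimal norm among integral ideals in its class; $D(z,r)$ is the closed disc of radius $r$ centered at $z$. A nonempty finite $B\subset\mathcal{O}\setminus\{0\}$ is admissible with $\varepsilon\in(0,1)$ if for every reduced ideal $\mathfrak{b}$ with $\mathfrak{b}\cap B\neq\emptyset$, $\mathbb{C}=\bigcup D(a/b,\varepsilon/|b|)$ over $a\in\mathfrak{b}^{-1}$, $b\in\mathfrak{b}\cap B$ with $(a\mathfrak{b},b/\mathfrak{b})$ reduced. Fix such $B,\varepsilon$ and let $\mu=\max_{b\in B}|b|$. Let $S(a,b)=\begin{bmatrix}a&1\\ b&0\end{bmatrix}$, $(M)_1$ the ideal generated by the first-column entries of $M$; matrices act as Möbius transformations. Given $z\in\mathbb{C}$, the continued fraction algorithm sets $M_0=I$, $b_0=1$, and for $n\ge1$ chooses (in any way) $b_n\in B$ and $a_n\in\mathcal{O}\cap D(b_nM_{n-1}^{-1}(z),\varepsilon|b_{n-1}|)$ with $(M_{n-1}S(a_n/b_{n-1},b_n/b_{n-1}))_1$ reduced, and sets $M_n=M_{n-1}S(a_n/b_{n-1},b_n/b_{n-1})$,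 stopping if $z$ equals the first-column ratio of $M_n$. Let $z_n=M_n^{-1}(z)$ and let $p_n,q_n$ be the left-column entries of $M_n$ (right-column entries $p_{n-1},q_{n-1}$, with $p_{-1}=0,q_{-1}=1$); the $p_n/q_n$ are the convergents. *)

theory Defs
  imports "HOL-Analysis.Analysis" "HOL-Algebra.QuotRing"
begin

definition quad_gen :: "int \<Rightarrow> complex" where
  "quad_gen \<Delta> = (of_int \<Delta> + csqrt (of_int \<Delta>)) / 2"

definition quad_order :: "int \<Rightarrow> complex set" where
  "quad_order \<Delta> = {of_int x + of_int y * quad_gen \<Delta> | x y. True}"

definition quad_field :: "int \<Rightarrow> complex set" where
  "quad_field \<Delta> = {of_rat x + of_rat y * quad_gen \<Delta> | x y. True}"

definition quad_ring :: "int \<Rightarrow> complex ring" where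
  "quad_ring \<Delta> = \<lparr>carrier = quad_order \<Delta>, monoid.mult = (*), one = 1, zero = 0, add = (+)\<rparr>"

definition integral_ideal :: "int \<Rightarrow> complex set \<Rightarrow> bool" where
  "integral_ideal \<Delta> I \<longleftrightarrow> ideal I (quad_ring \<Delta>) \<and> I \<noteq> {0}"

definition ideal_norm :: "int \<Rightarrow> complex set \<Rightarrow> nat" where
  "ideal_norm \<Delta> I = card (carrier (quad_ring \<Delta> Quot I))"

definition same_class :: "int \<Rightarrow> complex set \<Rightarrow> complex set \<Rightarrow> bool" where
  "same_class \<Delta> I J \<longleftrightarrow> (\<exists>x\<in>quad_field \<Delta> - {0}. J = (\<lambda>y. x * y) ` I)"

definition reduced_ideal :: "int \<Rightarrow> complex set \<Rightarrow> bool" where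
  "reduced_ideal \<Delta> I \<longleftrightarrow> integral_ideal \<Delta> I \<and>
     (\<forall>J. integral_ideal \<Delta> J \<and> same_class \<Delta> I J \<longrightarrow> ideal_norm \<Delta> I \<le> ideal_norm \<Delta> J)"

definition inverse_ideal :: "int \<Rightarrow> complex set \<Rightarrow> complex set" where
  "inverse_ideal \<Delta> I = {x \<in> quad_field \<Delta>. \<forall>y\<in>I. x * y \<in> quad_order \<Delta>}"

definition invertible_ideal :: "int \<Rightarrow> complex set \<Rightarrow> bool" where
  "invertible_ideal \<Delta> I \<longleftrightarrow>
     Idl\<^bsub>quad_ring \<Delta>\<^esub> {x * y | x y. x \<in> I \<and> y \<in> inverse_ideal \<Delta> I} = quad_order \<Delta>"

text \<open>
  The covering condition speaks of \<open>\<bb>\<close>'s inverse, so \<open>\<bb>\<close> has to be invertible. In a maximal order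
  every nonzero ideal is; the clause only matters if \<open>\<Delta>\<close> is not a fundamental discriminant. The
  ideal \<open>(a \<bb>, b/\<bb>)\<close> is the sum of \<open>a \<bb>\<close> and \<open>b \<bb>\<close>'s inverse.
\<close>

definition admissible :: "int \<Rightarrow> complex set \<Rightarrow> real \<Rightarrow> bool" where
  "admissible \<Delta> B \<epsilon> \<longleftrightarrow>
     finite B \<and> B \<noteq> {} \<and> B \<subseteq> quad_order \<Delta> - {0} \<and> 0 < \<epsilon> \<and> \<epsilon> < 1 \<and>
     (\<forall>\<bb>. reduced_ideal \<Delta> \<bb> \<and> invertible_ideal \<Delta> \<bb> \<and> \<bb> \<inter> B \<noteq> {} \<longrightarrow>
        UNIV = \<Union> {cball (a / b) (\<epsilon> / cmod b) | a b.
          a \<in> inverse_ideal \<Delta> \<bb> \<and> b \<in> \<bb> \<inter> B \<and>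
          reduced_ideal \<Delta> {a * u + b * v | u v. u \<in> \<bb> \<and> v \<in> inverse_ideal \<Delta> \<bb>}})"

definition S_mat :: "complex \<Rightarrow> complex \<Rightarrow> complex^2^2" where
  "S_mat a b = vector [vector [a, 1], vector [b, 0]]"

definition column_ideal :: "int \<Rightarrow> complex^2^2 \<Rightarrow> complex set" where
  "column_ideal \<Delta> M = {x * M $ 1 $ 1 + y * M $ 2 $ 1 | x y. x \<in> quad_order \<Delta> \<and> y \<in> quad_order \<Delta>}"

text \<open>Only meaningful as a complex number where the denominator does not vanish.\<close>

definition moebius :: "complex^2^2 \<Rightarrow> complex \<Rightarrow> complex" where
  "moebius M z = (M $ 1 $ 1 * z + M $ 1 $ 2) / (M $ 2 $ 1 * z + M $ 2 $ 2)"

primrec cf_mat :: "(nat \<Rightarrow> complex) \<Rightarrow> (nat \<Rightarrow> complex) \<Rightarrow> nat \<Rightarrow> complex^2^2" where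
  "cf_mat a b 0 = mat 1"
| "cf_mat a b (Suc n) = cf_mat a b n ** S_mat (a (Suc n) / b n) (b (Suc n) / b n)"

definition cf_p :: "(nat \<Rightarrow> complex) \<Rightarrow> (nat \<Rightarrow> complex) \<Rightarrow> nat \<Rightarrow> complex" where
  "cf_p a b n = cf_mat a b n $ 1 $ 1"

definition cf_q :: "(nat \<Rightarrow> complex) \<Rightarrow> (nat \<Rightarrow> complex) \<Rightarrow> nat \<Rightarrow> complex" where
  "cf_q a b n = cf_mat a b n $ 2 $ 1"

definition cf_z :: "(nat \<Rightarrow> complex) \<Rightarrow> (nat \<Rightarrow> complex) \<Rightarrow> complex \<Rightarrow> nat \<Rightarrow> complex" where
  "cf_z a b z n = moebius (matrix_inv (cf_mat a b n)) z"

text \<open>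
  The ratio is \<open>\<infinity>\<close>, hence different from \<open>z\<close>, if the denominator is \<open>0\<close> (as for the identity matrix);
  this must not be confused with \<open>z = 0\<close> via \<open>1 / 0 = 0\<close>.
\<close>

definition cf_stops :: "(nat \<Rightarrow> complex) \<Rightarrow> (nat \<Rightarrow> complex) \<Rightarrow> complex \<Rightarrow> nat \<Rightarrow> bool" where
  "cf_stops a b z n \<longleftrightarrow> cf_q a b n \<noteq> 0 \<and> z = cf_p a b n / cf_q a b n"

text \<open>
  \<open>a\<close> and \<open>b\<close> record the choices made in the first \<open>N\<close> steps of some execution on input \<open>z\<close>. An
  infinite execution is one for which this holds for all \<open>N\<close>.
\<close>

definition cf_run ::
  "int \<Rightarrow> complex set \<Rightarrow> real \<Rightarrow> complex \<Rightarrow> (nat \<Rightarrow> complex) \<Rightarrow> (nat \<Rightarrow> complex) \<Rightarrow> nat \<Rightarrow> bool" where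
  "cf_run \<Delta> B \<epsilon> z a b N \<longleftrightarrow> b 0 = 1 \<and>
     (\<forall>k<N. \<not> cf_stops a b z k \<and>
        b (Suc k) \<in> B \<and>
        a (Suc k) \<in> quad_order \<Delta> \<inter> cball (b (Suc k) * cf_z a b z k) (\<epsilon> * cmod (b k)) \<and>
        reduced_ideal \<Delta> (column_ideal \<Delta> (cf_mat a b (Suc k))))"

end

theory Submission
  imports Defs
begin

text \<open>
  Put \<open>D n = q\<^sub>n z - p\<^sub>n\<close>. The choice of \<open>a\<^sub>n\<close> says exactly that \<open>|D n| \<le> \<epsilon> |D (n - 1)|\<close>, and
  \<open>D (n - 1) = - z\<^sub>n D n\<close>. The determinant identity reads \<open>q\<^sub>n D (n - 1) - q\<^sub>n\<^sub>-\<^sub>1 D n = \<plusminus> b\<^sub>n\<close>, so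
  \<open>|q\<^sub>n D (n - 1)| \<le> \<mu> + \<epsilon>\<^sup>2 |q\<^sub>n\<^sub>-\<^sub>1 D (n - 2)|\<close>, and summing the geometric series gives
  \<open>|q\<^sub>n D (n - 1)| < \<mu> / (1 - \<epsilon>\<^sup>2)\<close>. Dividing by \<open>|z\<^sub>n|\<close> yields the first bound, shifting \<open>n\<close> the
  third, and \<open>|a\<^sub>n\<^sub>+\<^sub>1| \<le> (1 + \<epsilon>\<^sup>2) \<mu> |z\<^sub>n|\<close> the second.

  The bounds are false if a denominator on the right vanishes, as \<open>x / 0 = 0\<close>; this is where the
  ideals being reduced is used. If \<open>q\<^sub>n = 0\<close>, then \<open>p\<^sub>n\<close> is a nonzero element of the order of modulus
  \<open>|D n| < 1\<close>. If \<open>a\<^sub>n\<^sub>+\<^sub>1 = 0\<close>, two reduced ideals of the same class differ by a factor of modulus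
  less than 1, which is impossible since the norm of \<open>x I\<close> is \<open>|x|\<^sup>2\<close> times that of \<open>I\<close>.
\<close>

section \<open>Indices of additive subgroups\<close>

text \<open>Representatives are ordinary elements that can be added and mapped; the tower formula
  and the transport along injective maps rest on this.\<close>

definition transversal :: "'a::ab_group_add set \<Rightarrow> 'a set \<Rightarrow> 'a set \<Rightarrow> bool" where
  "transversal G H T \<longleftrightarrow> T \<subseteq> G \<and> (\<forall>g\<in>G. \<exists>!t. t \<in> T \<and> g - t \<in> H)"

definition add_subgroup :: "'a::ab_group_add set \<Rightarrow> bool" where
  "add_subgroup H \<longleftrightarrow> 0 \<in> H \<and> (\<forall>x\<in>H. \<forall>y\<in>H. x - y \<in> H)"

lemma add_subgroup_uminus: "add_subgroup H \<Longrightarrow> x \<in> H \<Longrightarrow> - x \<in> H"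
  unfolding add_subgroup_def by (metis diff_0)

lemma add_subgroup_diff: "add_subgroup H \<Longrightarrow> x \<in> H \<Longrightarrow> y \<in> H \<Longrightarrow> x - y \<in> H"
  unfolding add_subgroup_def by blast

lemma add_subgroup_add: "add_subgroup H \<Longrightarrow> x \<in> H \<Longrightarrow> y \<in> H \<Longrightarrow> x + y \<in> H"
  using add_subgroup_diff[of H x "- y"] add_subgroup_uminus[of H y] by simp

lemma add_subgroup_0: "add_subgroup H \<Longrightarrow> 0 \<in> H"
  unfolding add_subgroup_def by blast

lemma coset_eq_iff:
  assumes "add_subgroup H"
  shows "(\<lambda>h. h + x) ` H = (\<lambda>h. h + y) ` H \<longleftrightarrow> x - y \<in> H"
proof
  assume "(\<lambda>h. h + x) ` H = (\<lambda>h. h + y) ` H"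
  moreover have "x \<in> (\<lambda>h. h + x) ` H"
    using add_subgroup_0[OF assms] by (intro image_eqI[of _ _ 0]) auto
  ultimately show "x - y \<in> H" by force
next
  assume xy: "x - y \<in> H"
  have yx: "y - x \<in> H" using add_subgroup_uminus[OF assms xy] by simp
  show "(\<lambda>h. h + x) ` H = (\<lambda>h. h + y) ` H"
  proof (intro subset_antisym image_subsetI)
    fix h assume "h \<in> H"
    then show "h + x \<in> (\<lambda>h. h + y) ` H"
      using add_subgroup_add[OF assms _ xy] by (intro image_eqI[of _ _ "h + (x - y)"]) auto
  next
    fix h assume "h \<in> H"
    then show "h + y \<in> (\<lambda>h. h + x) ` H"
      using add_subgroup_add[OF assms _ yx] by (intro image_eqI[of _ _ "h + (y - x)"]) auto
  qed
qed

lemma transversal_card_cosets: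
  assumes H: "add_subgroup H" and T: "transversal G H T"
  shows "card ((\<lambda>x. (\<lambda>h. h + x) ` H) ` G) = card T"
proof -
  have "inj_on (\<lambda>x. (\<lambda>h. h + x) ` H) T"
  proof (rule inj_onI)
    fix s t assume st: "s \<in> T" "t \<in> T" "(\<lambda>h. h + s) ` H = (\<lambda>h. h + t) ` H"
    then have "s - t \<in> H" using coset_eq_iff[OF H] by blast
    moreover have "s - s \<in> H" using add_subgroup_0[OF H] by simp
    ultimately show "s = t" using st T unfolding transversal_def by blast
  qed
  moreover have "(\<lambda>x. (\<lambda>h. h + x) ` H) ` G = (\<lambda>x. (\<lambda>h. h + x) ` H) ` T"
  proof (intro subset_antisym image_subsetI)
    fix g assume "g \<in> G"
    then obtain t where "t \<in> T" "g - t \<in> H" using T unfolding transversal_def by blast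
    then show "(\<lambda>h. h + g) ` H \<in> (\<lambda>x. (\<lambda>h. h + x) ` H) ` T"
      using coset_eq_iff[OF H, of g t] by blast
  next
    fix t assume "t \<in> T"
    then show "(\<lambda>h. h + t) ` H \<in> (\<lambda>x. (\<lambda>h. h + x) ` H) ` G"
      using T unfolding transversal_def by blast
  qed
  ultimately show ?thesis by (simp add: card_image)
qed

text \<open>The predicate under \<open>SOME\<close> depends on \<open>g\<close> only through its
  coset, so a single representative is picked on a whole coset.\<close>

lemma transversal_exists:
  assumes H: "add_subgroup H"
  shows "\<exists>T. transversal G H T"
proof -
  define r where "r g = (SOME t. t \<in> G \<and> g - t \<in> H)" for g
  have r: "r g \<in> G \<and> g - r g \<in> H" if "g \<in> G" for g
    unfolding r_def by (rule someI[of _ g]) (use that add_subgroup_0[OF H] in simp)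
  have r_cong: "r g = r g'" if "g - g' \<in> H" for g g'
  proof -
    have "g - t \<in> H \<longleftrightarrow> g' - t \<in> H" for t
      using add_subgroup_add[OF H that, of "g' - t"] add_subgroup_diff[OF H _ that, of "g - t"]
      by fastforce
    then show ?thesis unfolding r_def by simp
  qed
  have "transversal G H (r ` G)"
    unfolding transversal_def
  proof (intro conjI ballI)
    show "r ` G \<subseteq> G" using r by blast
    fix g assume g: "g \<in> G"
    show "\<exists>!t. t \<in> r ` G \<and> g - t \<in> H"
    proof (rule ex1I[of _ "r g"])
      show "r g \<in> r ` G \<and> g - r g \<in> H" using r g by blast
      fix t assume "t \<in> r ` G \<and> g - t \<in> H"
      then obtain g' where g': "g' \<in> G" "t = r g'" "g - r g' \<in> H" by blast
      then have "(g - r g') - (g' - r g') \<in> H" using r add_subgroup_diff[OF H] by blast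
      then show "t = r g" using r_cong[of g g'] g' by simp
    qed
  qed
  then show ?thesis ..
qed

text \<open>Representatives of \<open>H\<close> in \<open>G\<close> are the sums
  \<open>s + t\<close>: first \<open>s\<close> is determined modulo \<open>K\<close>, then
  \<open>t\<close> modulo \<open>H\<close>.\<close>

lemma transversal_trans:
  assumes K: "add_subgroup K" and H: "H \<subseteq> K" and G: "add_subgroup G" "K \<subseteq> G"
    and S: "transversal G K S" and T: "transversal K H T"
  shows "\<exists>U. transversal G H U \<and> card U = card S * card T"
proof (intro exI conjI)
  let ?f = "\<lambda>(s, t). s + t"
  have uniq: "s = s' \<and> t = t'"
    if st: "s \<in> S" "t \<in> T" "s' \<in> S" "t' \<in> T" "g \<in> G" "g - (s + t) \<in> H" "g - (s' + t') \<in> H"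
    for g s t s' t'
  proof -
    have tK: "t \<in> K" "t' \<in> K" using T st unfolding transversal_def by blast+
    have 1: "g - s \<in> K" "g - s' \<in> K"
      using add_subgroup_add[OF K, of "g - (s + t)" t] add_subgroup_add[OF K, of "g - (s' + t')" t']
        st tK H by (auto simp: algebra_simps)
    then have s: "s = s'" using S st unfolding transversal_def by blast
    have "(g - s) - t \<in> H" "(g - s) - t' \<in> H" using st s by (auto simp: algebra_simps)
    then show ?thesis using 1 s T st unfolding transversal_def by blast
  qed
  have ex: "\<exists>s\<in>S. \<exists>t\<in>T. g - (s + t) \<in> H" if "g \<in> G" for g
  proof -
    obtain s where s: "s \<in> S" "g - s \<in> K" using S \<open>g \<in> G\<close> unfolding transversal_def by blast
    then obtain t where "t \<in> T" "(g - s) - t \<in> H" using T unfolding transversal_def by blast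
    then show ?thesis using s by (auto simp: algebra_simps)
  qed
  have sub: "s + t \<in> G" if "s \<in> S" "t \<in> T" for s t
    using S T G that add_subgroup_add[OF G(1)] unfolding transversal_def by blast
  show "transversal G H (?f ` (S \<times> T))"
    unfolding transversal_def
  proof (intro conjI ballI)
    show "?f ` (S \<times> T) \<subseteq> G" using sub by auto
    fix g assume g: "g \<in> G"
    then obtain s t where st: "s \<in> S" "t \<in> T" "g - (s + t) \<in> H" using ex by blast
    show "\<exists>!u. u \<in> ?f ` (S \<times> T) \<and> g - u \<in> H"
    proof (rule ex1I[of _ "s + t"])
      show "s + t \<in> ?f ` (S \<times> T) \<and> g - (s + t) \<in> H" using st by auto
      fix u assume "u \<in> ?f ` (S \<times> T) \<and> g - u \<in> H"
      then obtain s' t' where "s' \<in> S" "t' \<in> T" "u = s' + t'" "g - (s' + t') \<in> H" by auto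
      then show "u = s + t" using uniq[of s t s' t' g] st g by auto
    qed
  qed
  have "inj_on ?f (S \<times> T)"
  proof (rule inj_onI, clarsimp)
    fix s t s' t' assume st: "s \<in> S" "t \<in> T" "s' \<in> S" "t' \<in> T" and eq: "s + t = s' + t'"
    have tK: "t \<in> K" "t' \<in> K" and sG: "s \<in> G" using S T st unfolding transversal_def by blast+
    have "s - s' = t' - t" using eq by (simp add: algebra_simps)
    then have "s - s' \<in> K" using add_subgroup_diff[OF K tK(2) tK(1)] by simp
    moreover have "s - s \<in> K" using add_subgroup_0[OF K] by simp
    ultimately have "s = s'" using S st sG unfolding transversal_def by blast
    then show "s = s' \<and> t = t'" using eq by simp
  qed
  then show "card (?f ` (S \<times> T)) = card S * card T"
    by (simp add: card_image card_cartesian_product)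
qed

lemma transversal_image:
  assumes T: "transversal G H T" and f: "inj f" "\<And>x y. f (x - y) = f x - f y"
  shows "transversal (f ` G) (f ` H) (f ` T)"
  unfolding transversal_def
proof (intro conjI ballI)
  show "f ` T \<subseteq> f ` G" using T unfolding transversal_def by blast
  have mem: "f x - f y \<in> f ` H \<longleftrightarrow> x - y \<in> H" for x y
    using f(1) by (simp flip: f(2) add: inj_image_mem_iff)
  fix g assume "g \<in> f ` G"
  then obtain x where x: "x \<in> G" "g = f x" by blast
  then obtain t where t: "t \<in> T" "x - t \<in> H" "\<And>t'. t' \<in> T \<and> x - t' \<in> H \<Longrightarrow> t' = t"
    using T unfolding transversal_def by blast
  show "\<exists>!t. t \<in> f ` T \<and> g - t \<in> f ` H"
  proof (rule ex1I[of _ "f t"])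
    show "f t \<in> f ` T \<and> g - f t \<in> f ` H" using t(1,2) x mem by simp
    fix s assume s: "s \<in> f ` T \<and> g - s \<in> f ` H"
    then obtain t' where "t' \<in> T" "s = f t'" by blast
    then show "s = f t" using s t(3)[of t'] x(2) mem[of x t'] by simp
  qed
qed

section \<open>The index: tower formula and invariance under injective additive maps\<close>

definition add_index :: "'a::ab_group_add set \<Rightarrow> 'a set \<Rightarrow> nat" where
  "add_index G H = card ((\<lambda>x. (\<lambda>h. h + x) ` H) ` G)"

lemma add_index_eq_card:
  "add_subgroup H \<Longrightarrow> transversal G H T \<Longrightarrow> add_index G H = card T"
  unfolding add_index_def by (rule transversal_card_cosets)

lemma add_index_mult:
  assumes "add_subgroup G" "add_subgroup K" "add_subgroup H" "H \<subseteq> K" "K \<subseteq> G"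
  shows "add_index G H = add_index G K * add_index K H"
proof -
  obtain S T where ST: "transversal G K S" "transversal K H T"
    using transversal_exists assms by metis
  then obtain U where "transversal G H U" "card U = card S * card T"
    using transversal_trans assms by metis
  then show ?thesis using ST assms add_index_eq_card by metis
qed

lemma add_subgroup_image:
  assumes "add_subgroup H" and f: "\<And>x y. f (x - y) = f x - f y"
  shows "add_subgroup (f ` H)"
proof -
  have "f 0 = 0" using f[of 0 0] by simp
  then have "0 \<in> f ` H" using add_subgroup_0[OF assms(1)] by (metis image_eqI)
  moreover have "f x - f y \<in> f ` H" if "x \<in> H" "y \<in> H" for x y
    using add_subgroup_diff[OF assms(1) that] by (simp flip: f)
  ultimately show ?thesis unfolding add_subgroup_def by blast
qed

lemma add_index_image:
  assumes "add_subgroup H" "inj f" "\<And>x y. f (x - y) = f x - f y"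
  shows "add_index (f ` G) (f ` H) = add_index G H"
proof -
  obtain T where T: "transversal G H T" using transversal_exists assms by metis
  have "add_index (f ` G) (f ` H) = card (f ` T)"
    using add_index_eq_card[OF add_subgroup_image transversal_image[OF T]] assms by blast
  also have "\<dots> = card T" using assms(2) by (simp add: card_image inj_on_subset)
  also have "\<dots> = add_index G H" using add_index_eq_card[OF assms(1) T] by simp
  finally show ?thesis .
qed

lemma scaled_subgroup: "add_subgroup H \<Longrightarrow> add_subgroup ((*) (c::complex) ` H)"
  by (rule add_subgroup_image) (auto simp: algebra_simps)

lemma add_index_scaled:
  assumes "add_subgroup H" "(c::complex) \<noteq> 0"
  shows "add_index ((*) c ` G) ((*) c ` H) = add_index G H"
  using assms by (intro add_index_image) (auto simp: algebra_simps inj_on_def)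

text \<open>The elements of the quotient ring are the cosets \<open>I + x\<close>, so the norm sees
  only the additive groups.\<close>

lemma ideal_norm_eq_add_index: "ideal_norm \<Delta> I = add_index (quad_order \<Delta>) I"
proof -
  have "carrier (quad_ring \<Delta> Quot I) = (\<lambda>x. (\<lambda>h. h + x) ` I) ` quad_order \<Delta>"
    by (auto simp: FactRing_def A_RCOSETS_defs RCOSETS_def r_coset_def quad_ring_def image_def)
  then show ?thesis by (simp add: ideal_norm_def add_index_def)
qed

section \<open>Ideal norms in imaginary quadratic orders\<close>

locale imaginary_quadratic_order =
  fixes \<Delta> :: int
  assumes neg: "\<Delta> < 0" and disc: "\<Delta> mod 4 = 0 \<or> \<Delta> mod 4 = 1"
begin

section \<open>Arithmetic of the order: conjugation and norm form\<close>

abbreviation (input) "\<O> \<equiv> quad_order \<Delta>"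
abbreviation (input) "\<tau> \<equiv> quad_gen \<Delta>"

text \<open>The norm of \<open>\<tau>\<close>, that is \<open>\<tau>\<close> times its conjugate;
  the congruence condition on \<open>\<Delta>\<close> makes the division exact.\<close>

definition nrm :: int where "nrm = (\<Delta>\<^sup>2 - \<Delta>) div 4"

lemma four_nrm: "4 * nrm = \<Delta>\<^sup>2 - \<Delta>"
proof -
  obtain k where "\<Delta> = 4 * k \<or> \<Delta> = 4 * k + 1"
    using disc by (metis mult_div_mod_eq add.right_neutral)
  then have "4 dvd \<Delta>\<^sup>2 - \<Delta>"
    by (elim disjE) (simp_all add: power2_eq_square algebra_simps)
  then show ?thesis unfolding nrm_def by simp
qed

lemma Re_gen: "Re \<tau> = of_int \<Delta> / 2" and Im_gen: "Im \<tau> = sqrt (- of_int \<Delta>) / 2"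
  using neg by (simp_all add: quad_gen_def)

lemma Im_gen_pos: "Im \<tau> > 0"
  using neg by (simp add: Im_gen)

lemma cnj_gen: "cnj \<tau> = of_int \<Delta> - \<tau>"
  by (simp add: complex_eq_iff Re_gen)

lemma gen_mult_cnj: "\<tau> * (of_int \<Delta> - \<tau>) = of_int nrm"
proof -
  have "4 * real_of_int nrm = (of_int \<Delta>)\<^sup>2 - of_int \<Delta>"
    using four_nrm by (metis of_int_diff of_int_mult of_int_numeral of_int_power)
  moreover have "(sqrt (- real_of_int \<Delta>))\<^sup>2 = - of_int \<Delta>" using neg by simp
  ultimately show ?thesis
    by (simp add: complex_eq_iff Re_gen Im_gen power2_eq_square field_simps)
qed

lemma gen_square: "\<tau> * \<tau> = of_int \<Delta> * \<tau> - of_int nrm"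
  using gen_mult_cnj by (simp add: algebra_simps)

lemma quad_orderI: "of_int x + of_int y * \<tau> \<in> \<O>"
  unfolding quad_order_def by blast

lemma quad_orderE:
  assumes "u \<in> \<O>" obtains x y where "u = of_int x + of_int y * \<tau>"
  using assms unfolding quad_order_def by blast

lemma of_int_in_order: "of_int x \<in> \<O>"
  using quad_orderI[of x 0] by simp

lemma order_subgroup: "add_subgroup \<O>"
  unfolding add_subgroup_def
proof (intro conjI ballI)
  show "0 \<in> \<O>" using of_int_in_order[of 0] by simp
  fix u v assume "u \<in> \<O>" "v \<in> \<O>"
  then obtain x y x' y' where "u = of_int x + of_int y * \<tau>" "v = of_int x' + of_int y' * \<tau>"
    by (auto elim!: quad_orderE)
  then show "u - v \<in> \<O>" using quad_orderI[of "x - x'" "y - y'"] by (simp add: algebra_simps)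
qed

lemma order_mult:
  assumes "u \<in> \<O>" "v \<in> \<O>" shows "u * v \<in> \<O>"
proof -
  obtain x y x' y' where uv: "u = of_int x + of_int y * \<tau>" "v = of_int x' + of_int y' * \<tau>"
    using assms by (auto elim!: quad_orderE)
  have "u * v = of_int (x * x') + of_int (x * y' + y * x') * \<tau> + of_int (y * y') * (\<tau> * \<tau>)"
    unfolding uv by (simp add: algebra_simps)
  also have "\<dots> = of_int (x * x' - y * y' * nrm) + of_int (x * y' + y * x' + y * y' * \<Delta>) * \<tau>"
    unfolding gen_square by (simp add: algebra_simps)
  finally show ?thesis using quad_orderI by (simp only:)
qed

lemma cnj_order: "cnj ` \<O> = \<O>"
proof -
  have "cnj u \<in> \<O>" if "u \<in> \<O>" for u
  proof -
    obtain x y where "u = of_int x + of_int y * \<tau>" using \<open>u \<in> \<O>\<close> by (auto elim!: quad_orderE)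
    then have "cnj u = of_int (x + y * \<Delta>) + of_int (- y) * \<tau>"
      by (simp add: cnj_gen algebra_simps)
    then show ?thesis using quad_orderI by metis
  qed
  then show ?thesis by (metis complex_cnj_cnj image_eqI image_subsetI subsetI subset_antisym)
qed

text \<open>In coordinates \<open>|u|\<^sup>2\<close> is the norm form
  \<open>x\<^sup>2 + \<Delta> x y + nrm y\<^sup>2\<close>, which has integer coefficients.\<close>

lemma order_norm_int:
  assumes "u \<in> \<O>" shows "\<exists>m::nat. (cmod u)\<^sup>2 = of_nat m"
proof -
  obtain x y where u: "u = of_int x + of_int y * \<tau>" using assms by (auto elim!: quad_orderE)
  have "complex_of_real ((cmod u)\<^sup>2) = u * cnj u" by (rule complex_norm_square)
  also have "\<dots> = (of_int x + of_int y * \<tau>) * (of_int x + of_int y * (of_int \<Delta> - \<tau>))"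
    unfolding u by (simp add: cnj_gen)
  also have "\<dots> = of_int (x * x + x * y * \<Delta>) + of_int (y * y) * (\<tau> * (of_int \<Delta> - \<tau>))"
    by (simp add: algebra_simps)
  also have "\<dots> = complex_of_real (of_int (x * x + x * y * \<Delta> + y * y * nrm))"
    unfolding gen_mult_cnj by simp
  finally have "(cmod u)\<^sup>2 = of_int (x * x + x * y * \<Delta> + y * y * nrm)"
    using of_real_eq_iff by blast
  moreover from this have "0 \<le> x * x + x * y * \<Delta> + y * y * nrm"
    by (metis of_int_0_le_iff zero_le_power2)
  ultimately have "(cmod u)\<^sup>2 = of_nat (nat (x * x + x * y * \<Delta> + y * y * nrm))" by simp
  then show ?thesis ..
qed

lemma order_norm_ge_1:
  assumes "u \<in> \<O>" "u \<noteq> 0" shows "1 \<le> cmod u"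
proof -
  obtain m :: nat where m: "(cmod u)\<^sup>2 = of_nat m" using order_norm_int assms by blast
  have "m \<noteq> 0" using m assms by (cases m) auto
  then have "1\<^sup>2 \<le> (cmod u)\<^sup>2" unfolding m by simp
  then show ?thesis by (rule power2_le_imp_le) simp
qed

lemma order_coords_eq:
  assumes "of_int x + of_int y * \<tau> = of_int x' + of_int y' * \<tau>"
  shows "x = x' \<and> y = y'"
proof -
  have "of_int y * Im \<tau> = of_int y' * Im \<tau>" using arg_cong[OF assms, of Im] by simp
  then have "y = y'" using Im_gen_pos by simp
  then show ?thesis using assms by simp
qed

section \<open>Indices of principal ideals\<close>

lemma scaled_order_subset: "c \<in> \<O> \<Longrightarrow> (*) c ` \<O> \<subseteq> \<O>"
  using order_mult by blast

text \<open>The tower formula for \<open>c I \<subseteq> c \<O> \<subseteq> \<O>\<close>;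
  multiplication by \<open>c\<close> is injective, so the lower index is that of \<open>I\<close> in
  \<open>\<O>\<close>.\<close>

lemma add_index_order_mult:
  assumes "c \<in> \<O>" "c \<noteq> 0" "add_subgroup I" "I \<subseteq> \<O>"
  shows "add_index \<O> ((*) c ` I) = add_index \<O> ((*) c ` \<O>) * add_index \<O> I"
  using add_index_mult[of \<O> "(*) c ` \<O>" "(*) c ` I"] assms scaled_subgroup order_subgroup
    scaled_order_subset add_index_scaled[of I c \<O>] by (simp add: image_mono)

text \<open>Divisibility by \<open>m\<close> can be read off the integer coordinates, so the
  elements \<open>x + y \<tau>\<close> with \<open>0 \<le> x, y < m\<close> represent the
  classes.\<close>

lemma add_index_order_nat:
  assumes "m > 0"
  shows "add_index \<O> ((*) (of_nat m) ` \<O>) = m\<^sup>2"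
proof -
  let ?f = "\<lambda>(x, y). of_int x + of_int y * \<tau>"
  let ?A = "{0..<int m} \<times> {0..<int m}"
  have "inj_on ?f ?A" using order_coords_eq by (auto simp: inj_on_def)
  then have card: "card (?f ` ?A) = m\<^sup>2"
    by (simp add: card_image card_cartesian_product power2_eq_square)
  have mem: "of_int x + of_int y * \<tau> - (of_int x' + of_int y' * \<tau>) \<in> (*) (of_nat m) ` \<O>
      \<longleftrightarrow> int m dvd x - x' \<and> int m dvd y - y'" (is "?l \<longleftrightarrow> ?r") for x y x' y'
  proof
    assume ?l
    then obtain k l where "of_int x + of_int y * \<tau> - (of_int x' + of_int y' * \<tau>)
        = of_nat m * (of_int k + of_int l * \<tau>)" by (auto elim!: quad_orderE)
    then have "of_int (x - x') + of_int (y - y') * \<tau> = of_int (int m * k) + of_int (int m * l) * \<tau>"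
      by (simp add: algebra_simps)
    then show ?r using order_coords_eq by (metis dvd_triv_left)
  next
    assume ?r
    then obtain k l where "x - x' = int m * k" "y - y' = int m * l" by (auto elim!: dvdE)
    then have kl: "x = x' + int m * k" "y = y' + int m * l" by auto
    show ?l
      using quad_orderI[of k l]
      by (intro image_eqI[of _ _ "of_int k + of_int l * \<tau>"]) (auto simp: kl algebra_simps)
  qed
  have "transversal \<O> ((*) (of_nat m) ` \<O>) (?f ` ?A)"
    unfolding transversal_def
  proof (intro conjI ballI)
    show "?f ` ?A \<subseteq> \<O>" using quad_orderI by auto
    fix g assume "g \<in> \<O>"
    then obtain x y where g: "g = of_int x + of_int y * \<tau>" by (auto elim!: quad_orderE)
    have res: "x' = x mod int m" if "0 \<le> x'" "x' < int m" "int m dvd x - x'" for x x'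
      using that by (metis mod_eq_dvd_iff mod_pos_pos_trivial)
    show "\<exists>!t. t \<in> ?f ` ?A \<and> g - t \<in> (*) (of_nat m) ` \<O>"
    proof (rule ex1I[of _ "?f (x mod int m, y mod int m)"])
      show "?f (x mod int m, y mod int m) \<in> ?f ` ?A \<and>
          g - ?f (x mod int m, y mod int m) \<in> (*) (of_nat m) ` \<O>"
        using assms mem[of x y "x mod int m" "y mod int m"] unfolding g
        by (auto simp: dvd_minus_mod)
      fix t assume t: "t \<in> ?f ` ?A \<and> g - t \<in> (*) (of_nat m) ` \<O>"
      then obtain x' y' where t': "t = of_int x' + of_int y' * \<tau>" "0 \<le> x'" "x' < int m"
        "0 \<le> y'" "y' < int m" by auto
      with t have "int m dvd x - x' \<and> int m dvd y - y'" unfolding g by (simp only: mem)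
      then show "t = ?f (x mod int m, y mod int m)" using t' res by auto
    qed
  qed
  then show ?thesis
    using card add_index_eq_card scaled_subgroup[OF order_subgroup] by metis
qed

text \<open>Conjugation preserves the order, so \<open>c\<close> and its conjugate generate ideals of equal index, and
  the product of these indices is that of the integer \<open>|c|\<^sup>2\<close>.\<close>

lemma add_index_principal:
  assumes "c \<in> \<O>" "c \<noteq> 0"
  shows "of_nat (add_index \<O> ((*) c ` \<O>)) = (cmod c)\<^sup>2"
proof -
  obtain m :: nat where m: "(cmod c)\<^sup>2 = of_nat m" using order_norm_int assms by blast
  have "m > 0" using m assms by (cases m) auto
  have cc: "cnj c \<in> \<O>" using assms cnj_order by blast
  have "cnj ` (*) c ` \<O> = (*) (cnj c) ` cnj ` \<O>" by (simp add: image_image)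
  then have im: "cnj ` (*) c ` \<O> = (*) (cnj c) ` \<O>" by (simp add: cnj_order)
  have "add_index (cnj ` \<O>) (cnj ` (*) c ` \<O>) = add_index \<O> ((*) c ` \<O>)"
    by (intro add_index_image scaled_subgroup order_subgroup) (auto simp: inj_on_def)
  then have conj: "add_index \<O> ((*) (cnj c) ` \<O>) = add_index \<O> ((*) c ` \<O>)"
    by (simp add: im cnj_order)
  have "c * cnj c = of_nat m"
    using m complex_norm_square[of c] by simp
  then have "(*) c ` (*) (cnj c) ` \<O> = (*) (of_nat m) ` \<O>"
    by (simp add: image_image flip: mult.assoc)
  then have "m\<^sup>2 = add_index \<O> ((*) c ` (*) (cnj c) ` \<O>)"
    using add_index_order_nat[OF \<open>m > 0\<close>] by simp
  also have "\<dots> = (add_index \<O> ((*) c ` \<O>))\<^sup>2"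
    using add_index_order_mult[OF assms scaled_subgroup[OF order_subgroup] scaled_order_subset[OF cc]]
    by (simp add: conj power2_eq_square)
  finally have "m = add_index \<O> ((*) c ` \<O>)" by simp
  then show ?thesis using m by simp
qed

section \<open>Integral ideals and the behaviour of their norms under scaling\<close>

lemma integral_ideal_subgroup:
  assumes "integral_ideal \<Delta> I"
  shows "add_subgroup I" "I \<subseteq> \<O>" "\<And>u x. u \<in> \<O> \<Longrightarrow> x \<in> I \<Longrightarrow> u * x \<in> I"
proof -
  interpret ideal I "quad_ring \<Delta>" using assms unfolding integral_ideal_def by blast
  show sub: "I \<subseteq> \<O>" using a_subset by (simp add: quad_ring_def)
  show mult: "u * x \<in> I" if "u \<in> \<O>" "x \<in> I" for u x
    using I_l_closed[OF \<open>x \<in> I\<close>, of u] that by (simp add: quad_ring_def)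
  have "0 \<in> I" using additive_subgroup.zero_closed[OF additive_subgroup_axioms] by (simp add: quad_ring_def)
  \<comment> \<open>The difference is taken as \<open>x + (-1) * y\<close>, which avoids the
    additive inverse of the abstract ring.\<close>
  moreover have "x - y \<in> I" if "x \<in> I" "y \<in> I" for x y
    using additive_subgroup.a_closed[OF additive_subgroup_axioms \<open>x \<in> I\<close> mult[of "-1" y]] that of_int_in_order[of "-1"]
    by (simp add: quad_ring_def)
  ultimately show "add_subgroup I" unfolding add_subgroup_def by blast
qed

text \<open>An infinite quotient would have cardinality 0. A nonzero \<open>c \<in> I\<close>
  excludes it: the index of \<open>I\<close> divides that of \<open>c \<O>\<close>, which is
  \<open>|c|\<^sup>2\<close>.\<close>

lemma ideal_norm_pos:
  assumes "integral_ideal \<Delta> I" shows "ideal_norm \<Delta> I > 0"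
proof -
  note I = integral_ideal_subgroup[OF assms]
  have "I \<noteq> {0}" using assms unfolding integral_ideal_def by blast
  then obtain c where c: "c \<in> I" "c \<noteq> 0" using add_subgroup_0[OF I(1)] by blast
  have "(*) c ` \<O> \<subseteq> I" using I(3) c by (auto simp: mult.commute)
  then have "add_index \<O> ((*) c ` \<O>) = add_index \<O> I * add_index I ((*) c ` \<O>)"
    using add_index_mult order_subgroup scaled_subgroup I by blast
  moreover have "of_nat (add_index \<O> ((*) c ` \<O>)) = (cmod c)\<^sup>2"
    using add_index_principal c I by blast
  ultimately have "real (add_index \<O> I) * real (add_index I ((*) c ` \<O>)) = (cmod c)\<^sup>2" by simp
  then show ?thesis unfolding ideal_norm_eq_add_index using c by (cases "add_index \<O> I") auto
qed

text \<open>Clearing the denominator turns \<open>J = (u / v) I\<close> into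
  \<open>v J = u I\<close>; the index of this subgroup is then factored in two ways.\<close>

lemma ideal_norm_scaled:
  assumes "u \<in> \<O>" "v \<in> \<O>" "u \<noteq> 0" "v \<noteq> 0"
    and I: "add_subgroup I" "I \<subseteq> \<O>" and J: "J = (*) (u / v) ` I" "J \<subseteq> \<O>"
  shows "(cmod v)\<^sup>2 * ideal_norm \<Delta> J = (cmod u)\<^sup>2 * ideal_norm \<Delta> I"
proof -
  have "(*) v ` J = (*) u ` I" using assms(4) by (simp add: J(1) image_image)
  moreover have "add_subgroup J" unfolding J(1) by (rule scaled_subgroup[OF I(1)])
  ultimately have "add_index \<O> ((*) v ` \<O>) * add_index \<O> J = add_index \<O> ((*) u ` \<O>) * add_index \<O> I"
    using add_index_order_mult assms by metis
  then have "real (add_index \<O> ((*) v ` \<O>)) * add_index \<O> J = real (add_index \<O> ((*) u ` \<O>)) * add_index \<O> I"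
    by (metis of_nat_mult)
  then show ?thesis using add_index_principal assms by (simp add: ideal_norm_eq_add_index)
qed

text \<open>Extending the fraction by \<open>cnj v\<close> leaves an element of the order over a
  positive integer.\<close>

lemma quotient_in_field:
  assumes "u \<in> \<O>" "v \<in> \<O>" "v \<noteq> 0" shows "u / v \<in> quad_field \<Delta>"
proof -
  obtain m :: nat where m: "(cmod v)\<^sup>2 = of_nat m" using order_norm_int assms by blast
  have "cnj v \<in> \<O>" using assms cnj_order by blast
  then obtain x y where xy: "u * cnj v = of_int x + of_int y * \<tau>"
    using order_mult assms by (metis quad_orderE)
  have "u / v = u * cnj v / of_nat m"
    using complex_norm_square[of v] m assms by (simp add: field_simps)
  also have "\<dots> = of_rat (of_int x / of_nat m) + of_rat (of_int y / of_nat m) * \<tau>"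
    by (simp add: xy of_rat_divide add_divide_distrib)
  finally show ?thesis unfolding quad_field_def by blast
qed

end

section \<open>The continued fraction algorithm\<close>

lemma matrix_inv_2:
  fixes M :: "complex^2^2"
  assumes d: "M $ 1 $ 1 * M $ 2 $ 2 - M $ 1 $ 2 * M $ 2 $ 1 = d" "d \<noteq> 0"
  shows "matrix_inv M = vector [vector [M $ 2 $ 2 / d, - M $ 1 $ 2 / d], vector [- M $ 2 $ 1 / d, M $ 1 $ 1 / d]]"
    (is "_ = ?E")
proof -
  have 1: "M ** ?E = mat 1" "?E ** M = mat 1"
    using d by (auto simp: vec_eq_iff forall_2 matrix_matrix_mult_def sum_2 mat_def divide_simps)
  then have "\<exists>A'. M ** A' = mat 1 \<and> A' ** M = mat 1" by blast
  \<comment> \<open>\<open>matrix_inv\<close> is picked by \<open>SOME\<close>, so an inverse must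
    be exhibited first; uniqueness of inverses then identifies it with \<open>?E\<close>, the
    adjugate over the determinant.\<close>
  then have "M ** matrix_inv M = mat 1" unfolding matrix_inv_def by (rule someI2_ex) blast
  then have "?E ** (M ** matrix_inv M) = ?E" by simp
  then show ?thesis using 1 by (simp add: matrix_mul_assoc)
qed

section \<open>Recurrence and determinant of the matrices\<close>

lemma cf_mat_0: "cf_mat a b 0 $ 1 $ 1 = 1" "cf_mat a b 0 $ 1 $ 2 = 0"
  "cf_mat a b 0 $ 2 $ 1 = 0" "cf_mat a b 0 $ 2 $ 2 = 1"
  by (simp_all add: mat_def)

text \<open>By the second equation, determinants and inverses become expressions in consecutive
  \<open>p\<close> and \<open>q\<close>.\<close>

lemma cf_mat_Suc_col:
  "cf_mat a b (Suc k) $ i $ 1 = (a (Suc k) * cf_mat a b k $ i $ 1 + b (Suc k) * cf_mat a b k $ i $ 2) / b k"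
  "cf_mat a b (Suc k) $ i $ 2 = cf_mat a b k $ i $ 1"
  by (simp_all add: matrix_matrix_mult_def S_mat_def sum_2 add_divide_distrib algebra_simps)

text \<open>Each step multiplies the determinant by \<open>- b (n + 1) / b n\<close>, and the
  product telescopes from \<open>b 0 = 1\<close>.\<close>

lemma cf_mat_det:
  assumes "\<And>k. k \<le> n \<Longrightarrow> b k \<noteq> 0" "b 0 = 1"
  shows "cf_mat a b n $ 1 $ 1 * cf_mat a b n $ 2 $ 2 - cf_mat a b n $ 1 $ 2 * cf_mat a b n $ 2 $ 1
    = (- 1) ^ n * b n"
  using assms
proof (induction n)
  case 0
  then show ?case by (simp add: cf_mat_0 del: cf_mat.simps)
next
  case (Suc n)
  let ?M = "cf_mat a b n"
  have "cf_mat a b (Suc n) $ 1 $ 1 * cf_mat a b (Suc n) $ 2 $ 2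
      - cf_mat a b (Suc n) $ 1 $ 2 * cf_mat a b (Suc n) $ 2 $ 1
      = - (b (Suc n) / b n) * (?M $ 1 $ 1 * ?M $ 2 $ 2 - ?M $ 1 $ 2 * ?M $ 2 $ 1)"
    using Suc.prems(1)[of n] unfolding cf_mat_Suc_col by (simp add: field_simps)
  also have "\<dots> = - (b (Suc n) / b n) * ((- 1) ^ n * b n)" using Suc by simp
  also have "\<dots> = (- 1) ^ Suc n * b (Suc n)" using Suc.prems(1)[of n] by simp
  finally show ?case .
qed

section \<open>A fixed run: decay of \<open>D\<close> and growth of \<open>q\<close>\<close>

locale cf_execution = imaginary_quadratic_order +
  fixes B :: "complex set" and \<epsilon> \<mu> :: real and z :: complex
    and a b :: "nat \<Rightarrow> complex" and N :: nat
  assumes adm: "admissible \<Delta> B \<epsilon>" and mu: "\<mu> = Max (cmod ` B)"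
    and run: "cf_run \<Delta> B \<epsilon> z a b N"
begin

abbreviation (input) "M \<equiv> cf_mat a b"
abbreviation (input) "p \<equiv> cf_p a b"
abbreviation (input) "q \<equiv> cf_q a b"

definition D :: "nat \<Rightarrow> complex" where "D k = q k * z - p k"

lemma eps: "0 < \<epsilon>" "\<epsilon> < 1"
  using adm unfolding admissible_def by auto

lemma eps_square: "0 < \<epsilon>\<^sup>2" "\<epsilon>\<^sup>2 < 1"
  using eps by (auto simp: power_less_one_iff)

lemma b_0: "b 0 = 1"
  using run unfolding cf_run_def by blast

lemma b_in_B: "1 \<le> k \<Longrightarrow> k \<le> N \<Longrightarrow> b k \<in> B"
  using run unfolding cf_run_def by (cases k) auto

lemma b_order: "k \<le> N \<Longrightarrow> b k \<in> quad_order \<Delta>" and b_nz: "k \<le> N \<Longrightarrow> b k \<noteq> 0"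
  using b_in_B[of k] b_0 adm of_int_in_order[of 1] unfolding admissible_def by (cases k; auto)+

lemma b_le_mu: "1 \<le> k \<Longrightarrow> k \<le> N \<Longrightarrow> cmod (b k) \<le> \<mu>"
  using b_in_B[of k] adm unfolding mu admissible_def by auto

lemma mu_pos: "\<mu> > 0"
proof -
  obtain x where "x \<in> B" "x \<noteq> 0" using adm unfolding admissible_def by auto
  moreover have "cmod x \<le> \<mu>" using \<open>x \<in> B\<close> adm unfolding mu admissible_def by auto
  ultimately show ?thesis by (meson less_le_trans zero_less_norm_iff)
qed

lemma not_stops: "k < N \<Longrightarrow> \<not> cf_stops a b z k"
  using run unfolding cf_run_def by blast

lemma a_near: "k < N \<Longrightarrow> cmod (b (Suc k) * cf_z a b z k - a (Suc k)) \<le> \<epsilon> * cmod (b k)"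
  using run unfolding cf_run_def by (auto simp: dist_norm)

lemma column_reduced: "1 \<le> k \<Longrightarrow> k \<le> N \<Longrightarrow> reduced_ideal \<Delta> (column_ideal \<Delta> (M k))"
  using run unfolding cf_run_def by (cases k) auto

lemma det: "k \<le> N \<Longrightarrow> p k * M k $ 2 $ 2 - M k $ 1 $ 2 * q k = (- 1) ^ k * b k"
  using cf_mat_det[of k b a] b_nz b_0 unfolding cf_p_def cf_q_def by simp

text \<open>A nonzero determinant keeps \<open>p k\<close> and \<open>q k\<close> from vanishing
  together. If \<open>q k = 0\<close>, then \<open>D k = - p k\<close> is nonzero and the ratio is
  infinite.\<close>

lemma D_nz_iff:
  assumes "k \<le> N" shows "D k \<noteq> 0 \<longleftrightarrow> \<not> cf_stops a b z k"
proof -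
  have "p k \<noteq> 0 \<or> q k \<noteq> 0" using det[OF assms] b_nz[OF assms] by auto
  then show ?thesis unfolding D_def cf_stops_def by (cases "q k = 0") (auto simp: field_simps)
qed

text \<open>The determinant cancels in the Moebius quotient. The equation persists for
  \<open>D k = 0\<close>, where both sides are 0.\<close>

lemma cf_z_eq:
  assumes "k \<le> N"
  shows "cf_z a b z k = - (M k $ 2 $ 2 * z - M k $ 1 $ 2) / D k"
proof -
  let ?d = "(- 1) ^ k * b k"
  have d: "?d \<noteq> 0" using b_nz[OF assms] by simp
  have inv: "matrix_inv (M k) = vector [vector [M k $ 2 $ 2 / ?d, - M k $ 1 $ 2 / ?d],
      vector [- M k $ 2 $ 1 / ?d, M k $ 1 $ 1 / ?d]]"
    using matrix_inv_2[OF _ d, of "M k"] det[OF assms] unfolding cf_p_def cf_q_def by blast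
  have "cf_z a b z k = ((M k $ 2 $ 2 * z - M k $ 1 $ 2) / ?d) / ((p k - q k * z) / ?d)"
    unfolding cf_z_def moebius_def inv cf_p_def cf_q_def by (simp add: diff_divide_distrib)
  also have "\<dots> = (M k $ 2 $ 2 * z - M k $ 1 $ 2) / (p k - q k * z)" using d by simp
  also have "\<dots> = - (M k $ 2 $ 2 * z - M k $ 1 $ 2) / D k"
    unfolding D_def by (metis minus_diff_eq minus_divide_divide)
  finally show ?thesis .
qed

lemma cf_z_Suc_eq: "Suc k \<le> N \<Longrightarrow> cf_z a b z (Suc k) = - D k / D (Suc k)"
  using cf_z_eq[of "Suc k"] by (simp only: cf_mat_Suc_col D_def cf_p_def cf_q_def)

lemma D_Suc_le:
  assumes "k < N" shows "cmod (D (Suc k)) \<le> \<epsilon> * cmod (D k)"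
proof -
  \<comment> \<open>This is \<open>D (k - 1)\<close>, read off the right column so that
    \<open>k = 0\<close> is covered; there it equals \<open>z\<close>.\<close>
  let ?w = "M k $ 2 $ 2 * z - M k $ 1 $ 2"
  have Dk: "D k \<noteq> 0" using D_nz_iff not_stops assms by simp
  have zk: "?w = - cf_z a b z k * D k" using cf_z_eq[of k] assms Dk by simp
  have bk: "b k \<noteq> 0" using b_nz assms by simp
  have "D (Suc k) = (a (Suc k) * D k + b (Suc k) * ?w) / b k"
    unfolding D_def cf_p_def cf_q_def cf_mat_Suc_col using bk by (simp add: field_simps)
  also have "\<dots> = - (b (Suc k) * cf_z a b z k - a (Suc k)) * D k / b k"
    unfolding zk by (simp add: algebra_simps)
  finally have "cmod (D (Suc k)) = cmod (b (Suc k) * cf_z a b z k - a (Suc k)) * cmod (D k) / cmod (b k)"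
    by (simp add: norm_mult norm_divide norm_minus_commute)
  also have "\<dots> \<le> (\<epsilon> * cmod (b k)) * cmod (D k) / cmod (b k)"
    using a_near[OF assms] by (intro divide_right_mono mult_right_mono) auto
  also have "\<dots> = \<epsilon> * cmod (D k)" using bk by simp
  finally show ?thesis .
qed

lemma D_less_1:
  assumes "1 \<le> k" "k \<le> N" shows "cmod (D k) < 1"
proof -
  have "cmod (D k) \<le> \<epsilon> ^ k" using \<open>k \<le> N\<close>
  proof (induction k)
    \<comment> \<open>\<open>D 0 = - 1\<close>, because \<open>p 0 = 1\<close> and
      \<open>q 0 = 0\<close>.\<close>
    case 0
    show ?case by (simp add: D_def cf_p_def cf_q_def cf_mat_0 del: cf_mat.simps)
  next
    case (Suc k)
    then have "cmod (D (Suc k)) \<le> \<epsilon> * \<epsilon> ^ k"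
      using D_Suc_le[of k] eps by (meson Suc_leD Suc_le_lessD less_imp_le mult_left_mono order_trans)
    then show ?case by simp
  qed
  also have "\<dots> < 1" using eps assms by (simp add: power_less_one_iff)
  finally show ?thesis .
qed

lemma q_Suc_D_le:
  assumes "k < N" shows "cmod (q (Suc k) * D k) \<le> \<mu> + \<epsilon> * cmod (q k * D k)"
proof -
  have "q (Suc k) * D k = q k * D (Suc k) + (p (Suc k) * q k - p k * q (Suc k))"
    unfolding D_def by (simp add: algebra_simps)
  \<comment> \<open>The right column of \<open>M (k + 1)\<close> consists of \<open>p k\<close> and
    \<open>q k\<close>, so this is its determinant.\<close>
  also have "p (Suc k) * q k - p k * q (Suc k) = (- 1) ^ Suc k * b (Suc k)"
    using det[of "Suc k"] assms by (simp only: cf_mat_Suc_col cf_p_def cf_q_def Suc_le_eq)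
  finally have "cmod (q (Suc k) * D k) \<le> cmod (q k * D (Suc k)) + cmod ((- 1) ^ Suc k * b (Suc k))"
    by (metis norm_triangle_ineq)
  also have "\<dots> = cmod (q k) * cmod (D (Suc k)) + cmod (b (Suc k))"
    by (simp add: norm_mult norm_power)
  also have "\<dots> \<le> cmod (q k) * (\<epsilon> * cmod (D k)) + \<mu>"
    using D_Suc_le b_le_mu[of "Suc k"] assms by (intro add_mono mult_left_mono) auto
  finally show ?thesis by (simp add: norm_mult algebra_simps)
qed

lemma q_Suc_D_less:
  assumes "k < N" shows "cmod (q (Suc k) * D k) < \<mu> / (1 - \<epsilon>\<^sup>2)"
  using assms
proof (induction k)
  case 0
  \<comment> \<open>The recursive term of the estimate vanishes here; strictness then comes from
    \<open>\<epsilon> > 0\<close>.\<close>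
  have "q 0 = 0" by (simp add: cf_q_def cf_mat_0 del: cf_mat.simps)
  then have "cmod (q (Suc 0) * D 0) \<le> \<mu>" using q_Suc_D_le[of 0] 0 by simp
  also have "\<mu> < \<mu> / (1 - \<epsilon>\<^sup>2)" using mu_pos eps_square by (simp add: field_simps)
  finally show ?case .
next
  case (Suc k)
  have "cmod (q (Suc k) * D (Suc k)) \<le> \<epsilon> * cmod (q (Suc k) * D k)"
    using mult_left_mono[OF D_Suc_le[of k], of "cmod (q (Suc k))"] Suc.prems
    by (simp add: norm_mult algebra_simps)
  also have "\<dots> < \<epsilon> * (\<mu> / (1 - \<epsilon>\<^sup>2))"
    using Suc eps by (intro mult_strict_left_mono) auto
  \<comment> \<open>The outer \<open>\<epsilon>\<close> is the one in \<open>q_Suc_D_le\<close>, the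
    inner one comes from the decay of \<open>D\<close>.\<close>
  finally have "\<epsilon> * cmod (q (Suc k) * D (Suc k)) < \<epsilon> * (\<epsilon> * (\<mu> / (1 - \<epsilon>\<^sup>2)))"
    using eps by (intro mult_strict_left_mono)
  then have "cmod (q (Suc (Suc k)) * D (Suc k)) < \<mu> + \<epsilon> * (\<epsilon> * (\<mu> / (1 - \<epsilon>\<^sup>2)))"
    using q_Suc_D_le[OF Suc.prems] by linarith
  \<comment> \<open>The bound reproduces itself: it is the fixed point of
    \<open>c \<mapsto> \<mu> + \<epsilon>\<^sup>2 c\<close>.\<close>
  also have "\<dots> = \<mu> / (1 - \<epsilon>\<^sup>2)" using eps_square by (simp add: field_simps power2_eq_square)
  finally show ?case .
qed

section \<open>Nonvanishing of the denominators\<close>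

lemma q_nz:
  assumes "1 \<le> k" "k \<le> N" shows "q k \<noteq> 0"
proof
  assume q0: "q k = 0"
  have "p k \<noteq> 0" using det b_nz q0 assms by force
  \<comment> \<open>Reducedness supplies integrality, which places \<open>p k\<close> in the order
    although the recurrence divides by the \<open>b\<close>.\<close>
  have "integral_ideal \<Delta> (column_ideal \<Delta> (M k))"
    using column_reduced assms unfolding reduced_ideal_def by blast
  then have sub: "column_ideal \<Delta> (M k) \<subseteq> quad_order \<Delta>" by (rule integral_ideal_subgroup)
  have "p k = 1 * M k $ 1 $ 1 + 0 * M k $ 2 $ 1" by (simp add: cf_p_def)
  moreover have "1 \<in> quad_order \<Delta>" "0 \<in> quad_order \<Delta>"
    using of_int_in_order[of 1] of_int_in_order[of 0] by simp_all
  ultimately have "p k \<in> column_ideal \<Delta> (M k)" unfolding column_ideal_def by blast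
  then have "1 \<le> cmod (p k)" using order_norm_ge_1 sub \<open>p k \<noteq> 0\<close> by blast
  moreover have "cmod (D k) = cmod (p k)" by (simp add: D_def q0)
  ultimately show False using D_less_1[OF assms] by simp
qed

text \<open>As \<open>z\<^sub>k = - D (k - 1) / D k\<close>, the decay of \<open>D\<close> is a
  lower bound for \<open>|z\<^sub>k|\<close>.\<close>

lemma cf_z_bound:
  assumes "1 \<le> k" "k \<le> N" "D k \<noteq> 0" shows "1 \<le> \<epsilon> * cmod (cf_z a b z k)"
proof -
  obtain j where j: "k = Suc j" using assms(1) by (cases k) auto
  have "cmod (cf_z a b z k) = cmod (D j) / cmod (D k)"
    using cf_z_Suc_eq[of j] assms by (simp add: j norm_divide)
  moreover have "1 \<le> \<epsilon> * cmod (D j) / cmod (D k)"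
    using D_Suc_le[of j] assms by (simp add: j)
  ultimately show ?thesis by simp
qed

text \<open>If \<open>a (n + 1) = 0\<close>, the first column of \<open>M (n + 1)\<close> is \<open>b (n + 1) / b n\<close> times that of
  \<open>M (n - 1)\<close>, and this factor has modulus at most \<open>\<epsilon>\<^sup>2\<close>.\<close>

lemma a_nz:
  assumes "1 \<le> n" "n < N" shows "a (Suc n) \<noteq> 0"
proof
  assume a0: "a (Suc n) = 0"
  obtain j where j: "n = Suc j" using assms(1) by (cases n) auto
  let ?u = "b (Suc n)" and ?v = "b n"
  let ?I = "column_ideal \<Delta> (M j)" and ?J = "column_ideal \<Delta> (M (Suc n))"
  have uv: "?u \<in> quad_order \<Delta>" "?v \<in> quad_order \<Delta>" "?u \<noteq> 0" "?v \<noteq> 0"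
    using b_order b_nz assms by auto
  have Dn: "D n \<noteq> 0" using D_nz_iff not_stops assms by simp
  \<comment> \<open>With \<open>a (n + 1) = 0\<close> the disc condition bounds
    \<open>?u * z\<^sub>n\<close> itself; since \<open>1 \<le> \<epsilon> |z\<^sub>n|\<close>, this
    gives \<open>|?u| \<le> \<epsilon>\<^sup>2 |?v|\<close>.\<close>
  have "cmod ?u \<le> cmod ?u * (\<epsilon> * cmod (cf_z a b z n))"
    using mult_left_mono[OF cf_z_bound[OF assms(1) _ Dn], of "cmod ?u"] assms by simp
  also have "\<dots> = \<epsilon> * cmod (?u * cf_z a b z n - a (Suc n))" by (simp add: a0 norm_mult)
  also have "\<dots> \<le> \<epsilon> * (\<epsilon> * cmod ?v)" using a_near assms eps by (intro mult_left_mono) auto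
  also have "\<dots> = \<epsilon>\<^sup>2 * cmod ?v" by (simp add: power2_eq_square)
  also have "\<dots> < cmod ?v" using eps_square uv by simp
  finally have less: "cmod ?u < cmod ?v" .
  have "M (Suc n) $ i $ 1 = ?u / ?v * M j $ i $ 1" for i
    unfolding cf_mat_Suc_col(1)[of a b n] a0 by (simp add: j cf_mat_Suc_col del: cf_mat.simps)
  then have "x * M (Suc n) $ 1 $ 1 + y * M (Suc n) $ 2 $ 1
      = ?u / ?v * (x * M j $ 1 $ 1 + y * M j $ 2 $ 1)" for x y
    by (simp only:) (simp add: algebra_simps)
  then have J: "?J = (*) (?u / ?v) ` ?I"
    unfolding column_ideal_def image_def by (simp only:) blast
  have intJ: "integral_ideal \<Delta> ?J"
    using column_reduced[of "Suc n"] assms unfolding reduced_ideal_def by simp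
  have I: "add_subgroup ?I \<and> ?I \<subseteq> quad_order \<Delta> \<and> ideal_norm \<Delta> ?I \<le> ideal_norm \<Delta> ?J"
  proof (cases j)
    \<comment> \<open>A run asserts reducedness only from the first step on. Here the column ideal
      is the whole order, whose norm is at most 1 and hence at most the positive norm of
      \<open>?J\<close>.\<close>
    case 0
    have eq: "?I = quad_order \<Delta>"
      using of_int_in_order[of 0] by (auto simp: 0 column_ideal_def cf_mat_0 simp del: cf_mat.simps)
    have "(\<lambda>h. h + x) ` quad_order \<Delta> = (\<lambda>h. h + 0) ` quad_order \<Delta>" if "x \<in> quad_order \<Delta>" for x
      using coset_eq_iff[OF order_subgroup, of x 0] that by simp
    then have "(\<lambda>x. (\<lambda>h. h + x) ` quad_order \<Delta>) ` quad_order \<Delta> \<subseteq> {quad_order \<Delta>}" by auto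
    then have "add_index (quad_order \<Delta>) (quad_order \<Delta>) \<le> 1"
      unfolding add_index_def using card_mono[of "{quad_order \<Delta>}"] by fastforce
    then show ?thesis
      using ideal_norm_pos[OF intJ] order_subgroup unfolding eq by (simp add: ideal_norm_eq_add_index)
  next
    case (Suc i)
    then have red: "reduced_ideal \<Delta> ?I" using column_reduced[of j] assms j by simp
    have "?u / ?v \<in> quad_field \<Delta> - {0}" using quotient_in_field uv by simp
    then have "same_class \<Delta> ?I ?J" unfolding same_class_def using J by blast
    then show ?thesis using red intJ integral_ideal_subgroup unfolding reduced_ideal_def by blast
  qed
  have "(cmod ?v)\<^sup>2 * ideal_norm \<Delta> ?J = (cmod ?u)\<^sup>2 * ideal_norm \<Delta> ?I"
    using ideal_norm_scaled[OF uv _ _ J] I integral_ideal_subgroup(2)[OF intJ] by blast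
  also have "\<dots> \<le> (cmod ?u)\<^sup>2 * ideal_norm \<Delta> ?J" using I by (intro mult_left_mono) auto
  \<comment> \<open>The norm of \<open>?J\<close> may be cancelled because it is positive.\<close>
  finally have "(cmod ?v)\<^sup>2 \<le> (cmod ?u)\<^sup>2" using ideal_norm_pos[OF intJ] by simp
  then show False using less by (meson norm_ge_zero not_le power2_le_imp_le)
qed

section \<open>The three error bounds\<close>

lemma error_less_z:
  assumes "1 \<le> n" "n \<le> N" "\<not> cf_stops a b z n"
  shows "cmod (q n * D n) < \<mu> / ((1 - \<epsilon>\<^sup>2) * cmod (cf_z a b z n))"
proof -
  obtain j where j: "n = Suc j" using assms(1) by (cases n) auto
  have Dn: "D n \<noteq> 0" using D_nz_iff assms by simp
  have zn: "cmod (cf_z a b z n) > 0"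
    using cf_z_bound[OF assms(1,2) Dn] eps by (metis mult_zero_right norm_ge_zero not_one_le_zero order_less_le)
  have "D j = - cf_z a b z n * D n" using cf_z_Suc_eq[of j] assms Dn by (simp add: j)
  then have "cmod (q n * D n) * cmod (cf_z a b z n) = cmod (q n * D j)" by (simp add: norm_mult)
  also have "\<dots> < \<mu> / (1 - \<epsilon>\<^sup>2)" using q_Suc_D_less[of j] assms by (simp add: j)
  finally show ?thesis using zn by (simp add: pos_less_divide_eq flip: divide_divide_eq_left)
qed

lemma error_less_a:
  assumes "1 \<le> n" "n < N"
  shows "cmod (q n * D n) < (1 + \<epsilon>\<^sup>2) * \<mu>\<^sup>2 / ((1 - \<epsilon>\<^sup>2) * cmod (a (Suc n)))"
proof -
  let ?z = "cmod (cf_z a b z n)"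
  have Dn: "D n \<noteq> 0" using D_nz_iff not_stops assms by simp
  have zn: "1 \<le> \<epsilon> * ?z" using cf_z_bound assms Dn by simp
  then have z_pos: "?z > 0" by (metis mult_zero_right norm_ge_zero not_one_le_zero order_less_le)
  have "cmod (a (Suc n)) \<le> cmod (b (Suc n) * cf_z a b z n) + cmod (b (Suc n) * cf_z a b z n - a (Suc n))"
    by (metis norm_triangle_sub norm_minus_commute)
  \<comment> \<open>As \<open>1 \<le> n\<close>, \<open>b n\<close> lies in \<open>B\<close>, so the
    disc has radius at most \<open>\<epsilon> * \<mu>\<close>.\<close>
  also have "\<dots> \<le> \<mu> * ?z + \<epsilon> * \<mu>"
    using b_le_mu[of "Suc n"] b_le_mu[of n] a_near[OF assms(2)] assms eps
    by (intro add_mono) (auto simp: norm_mult intro: mult_right_mono order_trans)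
  \<comment> \<open>The radius is absorbed into a multiple of \<open>|z\<^sub>n|\<close> by
    \<open>1 \<le> \<epsilon> |z\<^sub>n|\<close>; hence the
    \<open>\<epsilon>\<^sup>2\<close>.\<close>
  also have "\<dots> \<le> \<mu> * ?z + \<epsilon> * \<mu> * (\<epsilon> * ?z)"
    using mult_left_mono[OF zn, of "\<epsilon> * \<mu>"] eps mu_pos by simp
  also have "\<dots> = (1 + \<epsilon>\<^sup>2) * \<mu> * ?z" by (simp add: algebra_simps power2_eq_square)
  finally have le: "cmod (a (Suc n)) \<le> (1 + \<epsilon>\<^sup>2) * \<mu> * ?z" .
  have "cmod (q n * D n) < \<mu> / ((1 - \<epsilon>\<^sup>2) * ?z)"
    using error_less_z assms not_stops by simp
  \<comment> \<open>The fraction is extended by \<open>(1 + \<epsilon>\<^sup>2) * \<mu>\<close> so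
    that the upper bound for \<open>|a\<^sub>n\<^sub>+\<^sub>1|\<close> appears in the
    denominator.\<close>
  also have "\<dots> = (1 + \<epsilon>\<^sup>2) * \<mu>\<^sup>2 / ((1 - \<epsilon>\<^sup>2) * ((1 + \<epsilon>\<^sup>2) * \<mu> * ?z))"
  proof -
    have "1 + \<epsilon>\<^sup>2 \<noteq> 0" using eps_square by linarith
    then show ?thesis using mu_pos by (simp add: power2_eq_square)
  qed
  \<comment> \<open>Shrinking the denominator to \<open>|a\<^sub>n\<^sub>+\<^sub>1|\<close> needs
    \<open>a (n + 1) \<noteq> 0\<close>.\<close>
  also have "\<dots> \<le> (1 + \<epsilon>\<^sup>2) * \<mu>\<^sup>2 / ((1 - \<epsilon>\<^sup>2) * cmod (a (Suc n)))"
    using le a_nz[OF assms] eps_square mu_pos z_pos add_pos_pos[OF zero_less_one eps_square(1)]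
    by (intro divide_left_mono mult_left_mono mult_pos_pos) auto
  finally show ?thesis .
qed

lemma error_less_q:
  assumes "1 \<le> n" "n < N"
  shows "cmod (q n * D n) < \<mu> * cmod (q n) / ((1 - \<epsilon>\<^sup>2) * cmod (q (Suc n)))"
proof -
  \<comment> \<open>\<open>q (n + 1) \<noteq> 0\<close> permits the division, and
    \<open>q n \<noteq> 0\<close> keeps the inequality strict after multiplication.\<close>
  have q: "cmod (q n) > 0" "cmod (q (Suc n)) > 0" using q_nz assms by auto
  have "cmod (D n) < \<mu> / (1 - \<epsilon>\<^sup>2) / cmod (q (Suc n))"
    unfolding pos_less_divide_eq[OF q(2)]
    using q_Suc_D_less[OF assms(2)] by (simp add: norm_mult mult.commute)
  then have "cmod (q n) * cmod (D n) < cmod (q n) * (\<mu> / (1 - \<epsilon>\<^sup>2) / cmod (q (Suc n)))"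
    using q by (intro mult_strict_left_mono)
  then show ?thesis by (simp add: norm_mult mult.commute)
qed

end

theorem theorem4:
  fixes \<Delta> :: int and B :: "complex set" and \<epsilon> \<mu> :: real and z :: complex
    and a b :: "nat \<Rightarrow> complex" and N n :: nat
  assumes "\<Delta> < 0" and "\<Delta> mod 4 = 0 \<or> \<Delta> mod 4 = 1"
    and "admissible \<Delta> B \<epsilon>"
    and "\<mu> = Max (cmod ` B)"
    and "cf_run \<Delta> B \<epsilon> z a b N"
    and "1 \<le> n" and "n \<le> N"
  shows "(\<not> cf_stops a b z n \<longrightarrow>
            cmod (cf_q a b n * (cf_q a b n * z - cf_p a b n))
              < \<mu> / ((1 - \<epsilon>\<^sup>2) * cmod (cf_z a b z n))) \<and>
         (n < N \<longrightarrow>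
            cmod (cf_q a b n * (cf_q a b n * z - cf_p a b n))
              < (1 + \<epsilon>\<^sup>2) * \<mu>\<^sup>2 / ((1 - \<epsilon>\<^sup>2) * cmod (a (n + 1))) \<and>
            cmod (cf_q a b n * (cf_q a b n * z - cf_p a b n))
              < \<mu> * cmod (cf_q a b n) / ((1 - \<epsilon>\<^sup>2) * cmod (cf_q a b (n + 1))))"
proof -
  interpret cf_execution \<Delta> B \<epsilon> \<mu> z a b N
    using assms by unfold_locales
  show ?thesis
    using error_less_z[of n] error_less_a[of n] error_less_q[of n] assms(6,7)
    unfolding D_def by simp
qed

end
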